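(* Let $q\in(0,1)$. Let $\{A_n\}_{n\ge 0}$ be a sequence of real numbers such that $A_0=0$, $A_1=1$, and put $$B_n=\frac{A_{n+1}(1-q^{n+1})}{1-q}-\frac{A_n(1-q^n)}{1-q}.$$ Suppose that either $$1\ge B_1\ge B_2\ge\cdots\ge B_n\ge\cdots\ge 0$$ or $$1\le B_1\le B_2\le\cdots\le B_n\le\cdots\le 2 .$$ Then $f(z)=z+\sum_{n=2}^\infty A_nz^n$ belongs to $\mathcal{K}_q$ with the function $g(z)=z/(1-z)^2$.
   Context: $\mathbb{D}=\{z\in\mathbb{C}:|z|<1\}$. $\mathcal{A}$ is the class of functions $f$ analytic in $\mathbb{D}$ with $f(0)=0=f'(0)-1$. $\mathcal{S}^*\subset\mathcal{A}$ is the class of univalent functions $g\in\mathcal{A}$ that are starlike with respect to the origin ($tw\in g(\mathbb{D})$ whenever $t\in[0,1]$, $w\in g(\mathbb{D})$). For $q\in(0,1)$ and $f\in\mathcal{A}$, the $q$-difference operator is $(D_qf)(z)=\dfrac{f(z)-f(qz)}{z(1-q)}$ for $z\in\mathbb{D}\setminus\{0\}$, and $(D_qf)(0)=f'(0)$. A function $f\in\mathcal{A}$ belongs to $\mathcal{K}_q$ ($q$-close-to-convex functions) if there exists $g\in\mathcal{S}^*$ such that $$\left|\frac{z}{g(z)}(D_qf)(z)-\frac{1}{1-q}\right|\le\frac{1}{1-q},\quad z\in\mathbb{D}$$ (where $z/g(z)$ is given its limit value $1$ at $z=0$); one then says that $f\in\mathcal{K}_q$ with the function $g$. *)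

theory Defs
  imports "HOL-Complex_Analysis.Complex_Analysis"
begin

abbreviation unit_disc :: "complex set" where
  "unit_disc \<equiv> ball 0 1"

definition class_A :: "(complex \<Rightarrow> complex) set" where
  "class_A = {f. f analytic_on unit_disc \<and> f 0 = 0 \<and> deriv f 0 = 1}"

text \<open>Starlikeness is with respect to the origin; the library predicate \<open>starlike\<close> allows
  an arbitrary centre.\<close>

definition starlike_class :: "(complex \<Rightarrow> complex) set" where
  "starlike_class = {g \<in> class_A. inj_on g unit_disc \<and>
     (\<forall>t\<in>{0..1::real}. \<forall>w\<in>g ` unit_disc. of_real t * w \<in> g ` unit_disc)}"

definition q_diff :: "real \<Rightarrow> (complex \<Rightarrow> complex) \<Rightarrow> complex \<Rightarrow> complex" where
  "q_diff q f z =
     (if z = 0 then deriv f 0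
      else (f z - f (of_real q * z)) / (z * (1 - of_real q)))"

text \<open>The quotient \<open>z / g z\<close> is completed by its limit 1 at the origin.\<close>

definition q_close_to_convex_with ::
    "real \<Rightarrow> (complex \<Rightarrow> complex) \<Rightarrow> (complex \<Rightarrow> complex) \<Rightarrow> bool" where
  "q_close_to_convex_with q f g \<longleftrightarrow>
     f \<in> class_A \<and> g \<in> starlike_class \<and>
     (\<forall>z\<in>unit_disc.
        norm ((if z = 0 then 1 else z / g z) * q_diff q f z - of_real (1 / (1 - q)))
          \<le> 1 / (1 - q))"

definition q_close_to_convex :: "real \<Rightarrow> (complex \<Rightarrow> complex) set" where
  "q_close_to_convex q = {f. \<exists>g. q_close_to_convex_with q f g}"

end

theory Submission
  imports Defs
begin

text \<open>
  Put \<open>C\<^sub>n = A\<^sub>n (1 - q\<^sup>n) / (1 - q)\<close>. These are the coefficients of \<open>z (D\<^sub>q f)(z)\<close>, and the \<open>B\<^sub>n\<close> are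
  their increments. Multiplying a power series by \<open>1 - z\<close> replaces its coefficients by their
  increments (lemma \<open>sums_mult_one_minus\<close>). For the Koebe function \<open>g\<close> one has \<open>z / g z = (1 - z)\<^sup>2\<close>,
  so applying this twice gives
  \<open>(z / g z) (D\<^sub>q f)(z) = (1 - z) (\<Sum>n. B n * z ^ n) = 1 + (\<Sum>n. (B (n + 1) - B n) * z ^ (n + 1))\<close>.
  Since \<open>B\<^sub>0 = 1\<close>, both alternatives on \<open>B\<close> say that the sequence, index \<open>0\<close> included, is monotone
  and stays within distance \<open>1\<close> of its initial value. Its total variation is therefore at most \<open>1\<close>,
  so the last series has modulus at most \<open>1\<close> (lemma \<open>norm_increment_series_le\<close>). The quotient thus lies in
  the closed disc of centre \<open>1\<close> and radius \<open>1\<close>, which is contained in the closed disc of centre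
  \<open>1 / (1 - q)\<close> and radius \<open>1 / (1 - q)\<close>: the two touch at the origin.

  Two side conditions remain. The \<open>B\<^sub>n\<close> are bounded by \<open>2\<close>, so \<open>A\<^sub>n\<close> grows at most linearly and the
  series for \<open>f\<close> converges in the disc. The Koebe function is starlike (lemma
  \<open>koebe_in_starlike_class\<close>) because it is a squaring map on the right half-plane in disguise.
\<close>

section \<open>Multiplying a power series by one minus its variable\<close>

lemma sums_mult_one_minus:
  fixes c :: "nat \<Rightarrow> 'a::real_normed_field"
  assumes "(\<lambda>n. c n * z ^ n) sums s"
  shows "(\<lambda>n. (c (Suc n) - c n) * z ^ Suc n) sums ((1 - z) * s - c 0)"
proof -
  have "(\<lambda>n. c (Suc n) * z ^ Suc n) sums (s - c 0)"
    using assms sums_Suc_iff[of "\<lambda>n. c n * z ^ n" "s - c 0"] by simp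
  from sums_diff[OF this sums_mult[OF assms, of z]] show ?thesis
    by (simp add: algebra_simps)
qed

text \<open>The increments of a monotone sequence share one sign, so their absolute values still telescope.\<close>

lemma sum_abs_increments_monoseq:
  fixes b :: "nat \<Rightarrow> real"
  assumes "monoseq b"
  shows "(\<Sum>k<n. \<bar>b (Suc k) - b k\<bar>) = \<bar>b n - b 0\<bar>"
  using monoseq_iff[THEN iffD1, OF assms]
proof
  assume "incseq b"
  then have "b k \<le> b (Suc k)" "b 0 \<le> b k" for k
    by (auto simp: incseq_def)
  then show ?thesis
    by (simp add: sum_lessThan_telescope)
next
  assume "decseq b"
  then have mono: "b (Suc k) \<le> b k" "b k \<le> b 0" for k
    by (auto simp: decseq_def)
  then have "(\<Sum>k<n. \<bar>b (Suc k) - b k\<bar>) = (\<Sum>k<n. - (b (Suc k) - b k))"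
    by (intro sum.cong) auto
  also have "\<dots> = - (b n - b 0)"
    by (simp only: sum_negf sum_lessThan_telescope)
  finally show ?thesis
    using mono(2)[of n] by simp
qed

text \<open>The coefficients are dominated in absolute value by the increments of \<open>b\<close>, whose total is the
  variation of \<open>b\<close>; the bound passes from the partial sums to the limit.\<close>

lemma norm_increment_series_le:
  fixes b :: "nat \<Rightarrow> real" and z :: complex
  assumes mono: "monoseq b" and bound: "\<And>n. \<bar>b n - b 0\<bar> \<le> M" and z: "norm z \<le> 1"
    and s: "(\<lambda>n. (of_real (b (Suc n)) - of_real (b n)) * z ^ Suc n) sums s"
  shows "norm s \<le> M"
proof (rule LIMSEQ_le_const2)
  show "(\<lambda>n. norm (\<Sum>k<n. (of_real (b (Suc k)) - of_real (b k)) * z ^ Suc k)) \<longlonglongrightarrow> norm s"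
    using s unfolding sums_def by (rule tendsto_norm)
  have summand: "norm ((of_real (b (Suc k)) - of_real (b k)) * z ^ Suc k) \<le> \<bar>b (Suc k) - b k\<bar>" for k
  proof -
    have "norm z ^ Suc k \<le> 1"
      using z by (intro power_le_one) auto
    then show ?thesis
      by (simp only: norm_mult norm_power flip: of_real_diff)
         (simp only: norm_of_real mult_left_le abs_ge_zero)
  qed
  have "norm (\<Sum>k<n. (of_real (b (Suc k)) - of_real (b k)) * z ^ Suc k) \<le> M" for n
  proof -
    have "norm (\<Sum>k<n. (of_real (b (Suc k)) - of_real (b k)) * z ^ Suc k)
        \<le> (\<Sum>k<n. \<bar>b (Suc k) - b k\<bar>)"
      using summand by (rule sum_norm_le)
    also have "\<dots> \<le> M"
      using bound[of n] by (simp only: sum_abs_increments_monoseq[OF mono])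
    finally show ?thesis .
  qed
  then show "\<exists>N. \<forall>n\<ge>N. norm (\<Sum>k<n. (of_real (b (Suc k)) - of_real (b k)) * z ^ Suc k) \<le> M"
    by blast
qed

section \<open>Starlikeness of the Koebe function\<close>

lemma inj_on_koebe: "inj_on (\<lambda>z. z / (1 - z)\<^sup>2) unit_disc"
proof (rule inj_onI)
  fix z w :: complex
  assume zw: "z \<in> unit_disc" "w \<in> unit_disc" and eq: "z / (1 - z)\<^sup>2 = w / (1 - w)\<^sup>2"
  have "z \<noteq> 1" "w \<noteq> 1"
    using zw by auto
  then have "z * (1 - w)\<^sup>2 = w * (1 - z)\<^sup>2"
    using eq by (simp add: frac_eq_eq)
  then have "(z - w) * (1 - z * w) = 0"
    by (simp add: power2_eq_square algebra_simps)
  moreover have "norm (z * w) < 1"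
    using zw mult_strict_mono'[of "norm z" 1 "norm w" 1] by (simp add: norm_mult)
  then have "1 - z * w \<noteq> 0"
    by auto
  ultimately show "z = w"
    by simp
qed

lemma Re_cayley_pos:
  assumes "norm z < 1"
  shows "Re ((1 + z) / (1 - z)) > 0"
proof -
  have "z \<noteq> 1"
    using assms by auto
  then have "(cmod (1 - z))\<^sup>2 > 0"
    by simp
  moreover have "Re ((1 + z) * cnj (1 - z)) = 1 - (cmod z)\<^sup>2"
    by (simp add: cmod_power2) (simp add: algebra_simps power2_eq_square)
  moreover have "(cmod z)\<^sup>2 < 1"
    using assms by (simp add: abs_square_less_1)
  ultimately show ?thesis
    by (simp only: complex_div_cnj[of "1 + z"] Re_divide_of_real flip: of_real_power) simp
qed

lemma norm_inverse_cayley_less_1: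
  assumes "Re p > 0"
  shows "norm ((p - 1) / (p + 1)) < 1"
proof -
  have "(cmod (p - 1))\<^sup>2 < (cmod (p + 1))\<^sup>2"
    using assms by (simp add: cmod_power2) (simp add: algebra_simps power2_eq_square)
  then have "cmod (p - 1) < cmod (p + 1)"
    by (rule power2_less_imp_less) simp
  then show ?thesis
    by (simp add: norm_divide divide_less_eq)
qed

text \<open>In the half-plane coordinate \<open>p = (1 + z) / (1 - z)\<close> the Koebe function is
  \<open>(p\<^sup>2 - 1) / 4\<close>, so scaling its value by \<open>t\<close> replaces \<open>p\<^sup>2\<close> by \<open>t p\<^sup>2 + (1 - t)\<close>. This point lies on
  the segment from \<open>p\<^sup>2\<close> to \<open>1\<close>. The squares of the right half-plane fill the plane slit along the
  nonpositive reals, which is star-shaped about \<open>1\<close>; hence the new point again has a square root in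
  the right half-plane, and that root yields the required preimage.\<close>

lemma koebe_image_scaled:
  fixes t :: real and z :: complex
  assumes z: "norm z < 1" and t: "0 \<le> t" "t \<le> 1"
  shows "\<exists>u. norm u < 1 \<and> u / (1 - u)\<^sup>2 = of_real t * (z / (1 - z)\<^sup>2)"
proof -
  define p where "p = (1 + z) / (1 - z)"
  define w where "w = of_real t * p\<^sup>2 + of_real (1 - t)"
  define r where "r = csqrt w"
  define u where "u = (r - 1) / (r + 1)"
  have Re_p: "Re p > 0"
    unfolding p_def by (rule Re_cayley_pos[OF z])
  have "w \<notin> \<real>\<^sub>\<le>\<^sub>0"
  proof
    assume "w \<in> \<real>\<^sub>\<le>\<^sub>0"
    then have Im0: "t * (2 * Re p * Im p) = 0" and Re0: "t * ((Re p)\<^sup>2 - (Im p)\<^sup>2) + (1 - t) \<le> 0"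
      by (auto simp: complex_nonpos_Reals_iff w_def power2_eq_square)
    show False
    proof (cases "t = 0")
      case True
      then show ?thesis
        using Re0 by simp
    next
      case False
      then have "Im p = 0"
        using Im0 Re_p by simp
      moreover have "t * (Re p)\<^sup>2 > 0"
        using False t Re_p by simp
      ultimately show ?thesis
        using Re0 t by simp
    qed
  qed
  moreover have "r\<^sup>2 = w"
    unfolding r_def by simp
  ultimately have "Re r \<noteq> 0"
    by (auto simp: complex_nonpos_Reals_iff power2_eq_square)
  then have Re_r: "Re r > 0"
    using Re_csqrt[of w] unfolding r_def by simp
  have "z \<noteq> 1"
    using z by auto
  then have koebe_z: "z / (1 - z)\<^sup>2 = (p\<^sup>2 - 1) / 4"
    unfolding p_def by (simp add: divide_simps) (simp add: power2_eq_square algebra_simps)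
  have r1: "r + 1 \<noteq> 0"
    using Re_r by (auto simp: complex_eq_iff)
  then have one_minus_u: "1 - u = 2 / (r + 1)"
    unfolding u_def by (simp add: divide_simps)
  have "u / (1 - u)\<^sup>2 = (r - 1) * (r + 1) / 4"
    using r1 unfolding one_minus_u by (simp add: u_def power2_eq_square)
  also have "\<dots> = (r\<^sup>2 - 1) / 4"
    by (simp add: power2_eq_square algebra_simps)
  also have "\<dots> = of_real t * (z / (1 - z)\<^sup>2)"
    unfolding koebe_z r_def power2_csqrt w_def by (simp add: algebra_simps)
  finally have "u / (1 - u)\<^sup>2 = of_real t * (z / (1 - z)\<^sup>2)" .
  moreover have "norm u < 1"
    unfolding u_def by (rule norm_inverse_cayley_less_1[OF Re_r])
  ultimately show ?thesis
    by blast
qed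

lemma koebe_in_starlike_class: "(\<lambda>z. z / (1 - z)\<^sup>2) \<in> starlike_class"
proof -
  have "(\<lambda>z::complex. z / (1 - z)\<^sup>2) analytic_on unit_disc"
    by (auto intro!: analytic_intros)
  moreover have "((\<lambda>z::complex. z / (1 - z)\<^sup>2) has_field_derivative 1) (at 0)"
    by (auto intro!: derivative_eq_intros)
  then have "deriv (\<lambda>z::complex. z / (1 - z)\<^sup>2) 0 = 1"
    by (rule DERIV_imp_deriv)
  moreover have "of_real t * w \<in> (\<lambda>z. z / (1 - z)\<^sup>2) ` unit_disc"
    if "t \<in> {0..1}" "w \<in> (\<lambda>z. z / (1 - z)\<^sup>2) ` unit_disc" for t :: real and w :: complex
  proof -
    from that obtain z where "norm z < 1" "w = z / (1 - z)\<^sup>2"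
      by auto
    moreover from this that obtain u
      where "norm u < 1" "u / (1 - u)\<^sup>2 = of_real t * (z / (1 - z)\<^sup>2)"
      using koebe_image_scaled[of z t] by auto
    ultimately show ?thesis
      by (auto intro!: image_eqI[of _ _ u])
  qed
  moreover have "0 / (1 - 0)\<^sup>2 = (0::complex)"
    by simp
  ultimately show ?thesis
    unfolding starlike_class_def class_A_def using inj_on_koebe by blast
qed

section \<open>Power series with coefficients of linear growth\<close>

lemma summable_linear_growth:
  fixes a :: "nat \<Rightarrow> complex" and z :: complex
  assumes a: "\<And>n. norm (a n) \<le> M * real n" and z: "norm z < 1"
  shows "summable (\<lambda>n. a n * z ^ n)"
proof (rule summable_comparison_test')
  \<comment> \<open>The formal derivative of the geometric series has coefficients \<open>n + 1\<close>.\<close>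
  have "summable (\<lambda>n. diffs (\<lambda>_. 1) n * norm z ^ n)"
    using z by (intro termdiff_converges[of _ 1]) (auto intro: summable_geometric)
  then have "summable (\<lambda>n. M * norm z * (diffs (\<lambda>_. 1) n * norm z ^ n))"
    by (rule summable_mult)
  then have "summable (\<lambda>n. M * real (Suc n) * norm z ^ Suc n)"
    by (simp add: diffs_def mult_ac)
  then show "summable (\<lambda>n. M * real n * norm z ^ n)"
    by (subst (asm) summable_Suc_iff)
  show "norm (a n * z ^ n) \<le> M * real n * norm z ^ n" if "0 \<le> n" for n
    using a[of n] by (simp add: norm_mult norm_power mult_right_mono)
qed

lemma power_series_in_class_A:
  assumes sums: "\<And>z. norm z < 1 \<Longrightarrow> (\<lambda>n. a n * z ^ n) sums f z" and a: "a 0 = 0" "a 1 = 1"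
  shows "f \<in> class_A"
proof -
  have "f holomorphic_on unit_disc"
    using sums by (intro power_series_holomorphic[where a = a]) auto
  then have "f analytic_on unit_disc"
    by (simp add: analytic_on_open)
  moreover have "f 0 = 0"
    using sums_unique2[OF sums[of 0] powser_sums_zero[of a]] a by simp
  moreover have "((\<lambda>z. \<Sum>n. a n * z ^ n) has_field_derivative (\<Sum>n. diffs a n * 0 ^ n)) (at 0)"
    using sums[of "1/2"] by (intro termdiffs_strong[of _ "1/2"]) (auto simp: sums_iff)
  then have "((\<lambda>z. \<Sum>n. a n * z ^ n) has_field_derivative 1) (at 0)"
    using a by (simp add: powser_zero diffs_def)
  then have "(f has_field_derivative 1) (at 0)"
    by (rule has_field_derivative_transform_within_open[of _ _ _ unit_disc])
       (use sums in \<open>auto simp: sums_iff\<close>)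
  then have "deriv f 0 = 1"
    by (rule DERIV_imp_deriv)
  ultimately show ?thesis
    unfolding class_A_def by simp
qed

section \<open>Coefficients producing close-to-convex functions\<close>

lemma q_diff_sums:
  fixes a :: "nat \<Rightarrow> complex"
  assumes sums: "\<And>z. norm z < 1 \<Longrightarrow> (\<lambda>n. a n * z ^ n) sums f z"
    and q: "0 < q" "q < 1" and z: "norm z < 1" "z \<noteq> 0"
  shows "(\<lambda>n. a n * of_real ((1 - q ^ n) / (1 - q)) * z ^ n) sums (z * q_diff q f z)"
proof -
  have "norm (of_real q * z) < 1"
    using q z mult_strict_mono'[of q 1 "norm z" 1] by (simp add: norm_mult)
  then have "(\<lambda>n. (a n * z ^ n - a n * (of_real q * z) ^ n) / (1 - of_real q))
      sums ((f z - f (of_real q * z)) / (1 - of_real q))"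
    using sums z(1) by (intro sums_divide sums_diff) auto
  moreover have "(a n * z ^ n - a n * (of_real q * z) ^ n) / (1 - of_real q)
      = a n * of_real ((1 - q ^ n) / (1 - q)) * z ^ n" for n
    by (simp add: power_mult_distrib algebra_simps diff_divide_distrib)
  ultimately show ?thesis
    using z by (simp add: q_diff_def)
qed

lemma nonneg_increments_le_linear:
  fixes C :: "nat \<Rightarrow> real"
  assumes "C 0 = 0" and "\<And>n. 0 \<le> C (Suc n) - C n" and "\<And>n. C (Suc n) - C n \<le> M"
  shows "\<bar>C n\<bar> \<le> M * real n"
proof -
  have "C n = (\<Sum>k<n. C (Suc k) - C k)"
    using assms(1) by (simp only: sum_lessThan_telescope)
  moreover have "0 \<le> (\<Sum>k<n. C (Suc k) - C k)"
    using assms(2) by (rule sum_nonneg)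
  moreover have "(\<Sum>k<n. C (Suc k) - C k) \<le> real (card {..<n}) * M"
    using assms(3) by (rule sum_bounded_above)
  ultimately show ?thesis
    by (simp add: mult.commute)
qed

text \<open>The \<open>q\<close>-analogue \<open>(1 - q ^ n) / (1 - q)\<close> of a positive integer \<open>n\<close> is at least \<open>1\<close>, so dividing by
  it does not spoil a growth bound.\<close>

lemma abs_le_mult_q_number:
  fixes q x :: real
  assumes "0 < q" "q < 1" "n \<ge> 1"
  shows "\<bar>x\<bar> \<le> \<bar>x * ((1 - q ^ n) / (1 - q))\<bar>"
proof -
  have "q ^ n \<le> q ^ 1"
    using assms by (intro power_decreasing) auto
  then have "1 \<le> (1 - q ^ n) / (1 - q)"
    using assms by simp
  then have "1 \<le> \<bar>(1 - q ^ n) / (1 - q)\<bar>"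
    by linarith
  from mult_left_mono[OF this abs_ge_zero[of x]] show ?thesis
    by (simp only: abs_mult mult_1_right)
qed

theorem theorem2p4:
  fixes q :: real and A B :: "nat \<Rightarrow> real" and f :: "complex \<Rightarrow> complex"
  assumes q: "0 < q" "q < 1"
    and A0: "A 0 = 0" and A1: "A 1 = 1"
    and B: "\<And>n. B n = A (n + 1) * (1 - q ^ (n + 1)) / (1 - q) - A n * (1 - q ^ n) / (1 - q)"
    and mono: "(B 1 \<le> 1 \<and> (\<forall>n\<ge>1. B (n + 1) \<le> B n) \<and> (\<forall>n\<ge>1. 0 \<le> B n)) \<or>
               (1 \<le> B 1 \<and> (\<forall>n\<ge>1. B n \<le> B (n + 1)) \<and> (\<forall>n\<ge>1. B n \<le> 2))"
    and f: "f = (\<lambda>z. z + (\<Sum>n. of_real (A (n + 2)) * z ^ (n + 2)))"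
  shows "(\<forall>z\<in>unit_disc. summable (\<lambda>n. of_real (A (n + 2)) * z ^ (n + 2))) \<and>
         f \<in> q_close_to_convex q \<and>
         q_close_to_convex_with q f (\<lambda>z. z / (1 - z)\<^sup>2)"
proof -
  define C where "C n = A n * ((1 - q ^ n) / (1 - q))" for n
  have B_C: "B n = C (Suc n) - C n" for n
    by (simp add: B C_def)
  have C0: "C 0 = 0"
    by (simp add: C_def)
  have B0: "B 0 = 1"
    using q A0 A1 by (simp add: B)

  \<comment> \<open>The value \<open>B 0 = 1\<close> extends either chain of inequalities down to index \<open>0\<close>.\<close>
  have B_Suc: "(\<forall>n. B (Suc n) \<le> B n) \<or> (\<forall>n. B n \<le> B (Suc n))"
  proof -
    have "n = 0 \<or> n \<ge> 1" for n :: nat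
      by linarith
    then show ?thesis
      using mono B0 by (metis One_nat_def Suc_eq_plus1)
  qed
  then have B_mono: "monoseq B"
    by (auto simp: monoseq_Suc)
  have B_bounds: "0 \<le> B n" "B n \<le> 2" for n
  proof -
    have "B n \<in> {0..2}"
    proof (cases "n = 0")
      case True
      then show ?thesis
        using B0 by simp
    next
      case False
      then have n: "n \<ge> 1"
        by simp
      from mono show ?thesis
      proof
        assume *: "B 1 \<le> 1 \<and> (\<forall>n\<ge>1. B (n + 1) \<le> B n) \<and> (\<forall>n\<ge>1. 0 \<le> B n)"
        from n have "B n \<le> 1"
          by (induction n rule: dec_induct) (use * in \<open>auto intro: order_trans\<close>)
        then show ?thesis
          using * n by simp
      next
        assume *: "1 \<le> B 1 \<and> (\<forall>n\<ge>1. B n \<le> B (n + 1)) \<and> (\<forall>n\<ge>1. B n \<le> 2)"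
        from n have "1 \<le> B n"
          by (induction n rule: dec_induct) (use * in \<open>auto intro: order_trans\<close>)
        then show ?thesis
          using * n by simp
      qed
    qed
    then show "0 \<le> B n" "B n \<le> 2"
      by auto
  qed
  have B_near: "\<bar>B n - B 0\<bar> \<le> 1" for n
    using B_bounds[of n] B0 by simp

  have "\<bar>C n\<bar> \<le> 2 * real n" for n
    using C0 B_bounds B_C by (intro nonneg_increments_le_linear) auto
  then have "\<bar>A n\<bar> \<le> 2 * real n" for n
  proof (cases "n = 0")
    case False
    then show ?thesis
      using abs_le_mult_q_number[OF q, of n "A n"] \<open>\<bar>C n\<bar> \<le> 2 * real n\<close> by (simp add: C_def)
  qed (simp add: A0)
  then have summable_A: "summable (\<lambda>n. of_real (A n) * z ^ n)" if "norm z < 1" for z :: complex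
    using that by (intro summable_linear_growth[where M = 2]) auto
  then have summable_tail: "summable (\<lambda>n. of_real (A (n + 2)) * z ^ (n + 2))"
    if "norm z < 1" for z :: complex
    using that by (subst summable_iff_shift)
  have f_sums: "(\<lambda>n. of_real (A n) * z ^ n) sums f z" if "norm z < 1" for z
    using sums_iff_shift[THEN iffD1, OF summable_sums[OF summable_tail[OF that]]] A0 A1
    by (simp add: f numeral_2_eq_2 add.commute)
  have f_class: "f \<in> class_A"
    using f_sums by (rule power_series_in_class_A) (use A0 A1 in auto)

  have near_1: "norm ((1 - z)\<^sup>2 * q_diff q f z - 1) \<le> 1" if z: "norm z < 1" "z \<noteq> 0" for z
  proof -
    have "(\<lambda>n. of_real (C n) * z ^ n) sums (z * q_diff q f z)"
      using q_diff_sums[OF f_sums q z] by (simp only: C_def of_real_mult)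
    from sums_mult_one_minus[OF this]
    have "(\<lambda>n. of_real (B n) * z ^ Suc n) sums ((1 - z) * (z * q_diff q f z))"
      by (simp only: C0 B_C of_real_diff of_real_0 diff_zero)
    from sums_divide[OF this, of z]
    have "(\<lambda>n. of_real (B n) * z ^ n) sums ((1 - z) * q_diff q f z)"
      using z(2) by simp
    from sums_mult_one_minus[OF this]
    have "(\<lambda>n. (of_real (B (Suc n)) - of_real (B n)) * z ^ Suc n)
        sums ((1 - z)\<^sup>2 * q_diff q f z - 1)"
      by (simp only: B0 of_real_1 power2_eq_square mult.assoc)
    with B_mono B_near less_imp_le[OF z(1)] show ?thesis
      by (rule norm_increment_series_le)
  qed
  have "norm ((if z = 0 then 1 else z / (z / (1 - z)\<^sup>2)) * q_diff q f z - of_real (1 / (1 - q)))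
      \<le> 1 / (1 - q)" if z: "norm z < 1" for z
  proof -
    let ?Q = "(if z = 0 then 1 else z / (z / (1 - z)\<^sup>2)) * q_diff q f z"
    have "norm (?Q - 1) \<le> 1"
      using near_1[OF z] f_class by (auto simp: q_diff_def class_A_def)
    moreover have "norm (1 - of_real (1 / (1 - q)) :: complex) = 1 / (1 - q) - 1"
    proof -
      have "norm (1 - of_real (1 / (1 - q)) :: complex) = \<bar>1 - 1 / (1 - q)\<bar>"
        by (metis norm_of_real of_real_1 of_real_diff)
      moreover have "1 \<le> 1 / (1 - q)"
        using q by simp
      ultimately show ?thesis
        by linarith
    qed
    ultimately show ?thesis
      using norm_triangle_ineq[of "?Q - 1" "1 - of_real (1 / (1 - q))"] by simp
  qed
  then have with_koebe: "q_close_to_convex_with q f (\<lambda>z. z / (1 - z)\<^sup>2)"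
    unfolding q_close_to_convex_with_def using f_class koebe_in_starlike_class by simp
  then have "f \<in> q_close_to_convex q"
    unfolding q_close_to_convex_def by blast
  then show ?thesis
    using summable_tail with_koebe by simp
qed

end
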